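(* Let $p\in(0,\infty)$ and let $(Y,d_Y)$ be a metric space that is infrasup-umbel $p$-convex. Then the compression rate of any equi-coarse embedding of the countably branching trees $\{\mathsf T^\omega_k\}_{k\ge1}$ into $Y$ satisfies $$\int_1^\infty\Big(\frac{\rho(t)}{t}\Big)^p\frac{dt}{t}<\infty .$$ That is: whenever $\rho,\omega\colon[0,\infty)\to[0,\infty)$ are non-decreasing with $\lim_{t\to\infty}\rho(t)=\infty$ and there are maps $f_k\colon\mathsf T^\omega_k\to Y$ ($k\ge1$) with $\rho(d_{\mathsf T}(x,y))\le d_Y(f_k(x),f_k(y))\le\omega(d_{\mathsf T}(x,y))$ for all $k\ge 1$ and $x,y\in\mathsf T_k^\omega$, the integral $\int_1^\infty\big(\frac{\rho(t)}{t}\big)^p\frac{dt}{t}$ is finite.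
   Context: **Notation.** $\mathbb N=\{1,2,\dots\}$. $[\mathbb N]^{h}$ (resp. $[\mathbb N]^{\le h}$) is the set of subsets of $\mathbb N$ of size exactly $h$ (resp. at most $h$), whose elements are written as increasing tuples $\bar n=(n_1,\dots,n_\ell)$, $n_1<\dots<n_\ell$. $(\bar n,i,\bar m)$ denotes concatenation, and "$(\bar n,i,\bar m)\in[\mathbb N]^{\le h}$" means that the concatenated tuple is strictly increasing and of length at most $h$. **Countably branching tree.** $\mathsf T^\omega_h$ is the graph with vertex set $[\mathbb N]^{\le h}$ in which $(m_1,\dots,m_i)$ and $(n_1,\dots,n_j)$ form an edge iff $j=i+1$ and $m_1=n_1,\dots,m_i=n_i$ (or vice versa), equipped with the shortest path metric $d_{\mathsf T}$. **Infrasup-umbel $p$-convexity.** A metric space $(M,d)$ is infrasup-umbel $p$-convex if there is $C>0$ such that for all $k\ge1$ and all $f\colon\mathsf T^\omega_{2^k}\to M$, $$\sum_{s=1}^{k-1}\ \inf_{\bar n\in[\mathbb N]^{\le 2^k-2^s}}\ \inf_{i\ne j\in\mathbb N}\ \inf_{\substack{\bar m,\bar m'\in[\mathbb N]^{2^s-1}:\\(\bar n,i,\bar m),(\bar n,j,\bar m')\in[\mathbb N]^{\le2^k}}}\frac{d(f(\bar n,i,\bar m),f(\bar n,j,\bar m'))^p}{2^{sp}}\le C^p\,\mathrm{Lip}(f)^p,$$ where $\mathrm{Lip}(f)$ is the Lipschitz constant of $f$ and an infimum over the empty set is $+\infty$. *)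

theory Defs
  imports "HOL-Analysis.Analysis"
begin

section \<open>Countably branching trees\<close>

text \<open>A finite set of positive integers is encoded as the strictly increasing list of its
  elements, so concatenation of tuples is list append.\<close>

definition incseqs :: "nat list set" where
  "incseqs = {ns. sorted_wrt (<) ns \<and> set ns \<subseteq> {1..}}"

definition incseqs_eq :: "nat \<Rightarrow> nat list set" where
  "incseqs_eq h = {ns \<in> incseqs. length ns = h}"

definition incseqs_le :: "nat \<Rightarrow> nat list set" where
  "incseqs_le h = {ns \<in> incseqs. length ns \<le> h}"

definition tree_edges :: "nat \<Rightarrow> (nat list \<times> nat list) set" where
  "tree_edges h = {(ms, ns). ms \<in> incseqs_le h \<and> ns \<in> incseqs_le h \<and>
     (\<exists>a. ns = ms @ [a] \<or> ms = ns @ [a])}"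

text \<open>\<^term>\<open>E ^^ l\<close> relates two vertices iff they are joined by a walk of length \<^term>\<open>l\<close>. The
  minimum below exists for all pairs of vertices, as each vertex is joined to the root
  \<^term>\<open>[]\<close>.\<close>

definition tree_dist :: "nat \<Rightarrow> nat list \<Rightarrow> nat list \<Rightarrow> nat" where
  "tree_dist h x y = (LEAST l. (x, y) \<in> tree_edges h ^^ l)"

section \<open>Infrasup-umbel convexity\<close>

definition Lip :: "'a set \<Rightarrow> ('a \<Rightarrow> 'a \<Rightarrow> real) \<Rightarrow> ('b \<Rightarrow> 'b \<Rightarrow> real) \<Rightarrow> ('a \<Rightarrow> 'b) \<Rightarrow> ennreal" where
  "Lip X dX dM f = (SUP (x, y) \<in> {(x, y). x \<in> X \<and> y \<in> X \<and> x \<noteq> y}. ennreal (dM (f x) (f y) / dX x y))"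

text \<open>Real powers on \<open>[0, \<infinity>]\<close>, only meant for positive exponents (so that \<open>0\<^sup>p = 0\<close> and
  \<open>\<infinity>\<^sup>p = \<infinity>\<close>).\<close>

definition ennreal_powr :: "ennreal \<Rightarrow> real \<Rightarrow> ennreal" where
  "ennreal_powr x p = (if x = \<infinity> then \<infinity> else ennreal (enn2real x powr p))"

text \<open>The infima are taken in \<^typ>\<open>ennreal\<close>, so an infimum over the empty set is \<open>\<infinity>\<close>; this occurs
  whenever \<open>i\<close> or \<open>j\<close> does not exceed the last entry of \<open>ns\<close>. Maps that are not Lipschitz have
  \<^term>\<open>Lip X dX dM f = \<infinity>\<close> and satisfy the inequality trivially.\<close>

definition infrasup_umbel_convex :: "real \<Rightarrow> 'a set \<Rightarrow> ('a \<Rightarrow> 'a \<Rightarrow> real) \<Rightarrow> bool" where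
  "infrasup_umbel_convex p M d \<longleftrightarrow>
    (\<exists>C::real. C > 0 \<and> (\<forall>k\<ge>1. \<forall>f \<in> incseqs_le (2 ^ k) \<rightarrow> M.
      (\<Sum>s = 1..k - 1.
         INF ns \<in> incseqs_le (2 ^ k - 2 ^ s).
         INF (i, j) \<in> {(i, j). i \<in> {1..} \<and> j \<in> {1..} \<and> i \<noteq> j}.
         INF (ms, ms') \<in> {(ms, ms'). ms \<in> incseqs_eq (2 ^ s - 1) \<and> ms' \<in> incseqs_eq (2 ^ s - 1) \<and>
                             ns @ i # ms \<in> incseqs_le (2 ^ k) \<and> ns @ j # ms' \<in> incseqs_le (2 ^ k)}.
           ennreal (d (f (ns @ i # ms)) (f (ns @ j # ms')) powr p / 2 powr (real s * p)))
      \<le> ennreal (C powr p) *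
         ennreal_powr (Lip (incseqs_le (2 ^ k)) (\<lambda>x y. real (tree_dist (2 ^ k) x y)) d f) p))"

end

theory Submission
  imports Defs "HOL-Library.Sublist"
begin

text \<open>Restrict the convexity inequality to the maps \<open>f (2 ^ k)\<close>. Their Lipschitz constants are at
  most \<open>\<omega> 1\<close>, since any two vertices are joined by a path of edges. Two vertices that branch off
  at a common ancestor and lie \<open>2 ^ s\<close> below it are at distance at least \<open>2 ^ (s + 1)\<close>, so the
  \<open>s\<close>-th infimum is at least \<open>(\<rho> (2 ^ (s + 1)) / 2 ^ s) powr p\<close>. The partial sums of these numbers
  are therefore bounded uniformly in \<open>k\<close>, and since \<open>\<rho>\<close> is non-decreasing, the \<open>s\<close>-th number
  dominates the integral over \<open>[2 ^ s, 2 ^ (s + 1))\<close>.\<close>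

lemma incseqs_le_append1D: "xs @ [a] \<in> incseqs_le h \<Longrightarrow> xs \<in> incseqs_le h"
  by (auto simp: incseqs_le_def incseqs_def sorted_wrt_append)

lemma sym_tree_edges: "sym (tree_edges h)"
  by (auto simp: sym_def tree_edges_def)

lemma sym_relpow:
  assumes "sym R" "(x, y) \<in> R ^^ n"
  shows "(y, x) \<in> R ^^ n"
  using assms(2)
proof (induction n arbitrary: y)
  case (Suc n)
  then obtain z where "(x, z) \<in> R ^^ n" "(z, y) \<in> R" by auto
  then show ?case
    by (intro relpow_Suc_I2[of y z]) (auto intro: Suc.IH symD[OF assms(1)])
qed auto

lemma walk_from_root:
  "xs \<in> incseqs_le h \<Longrightarrow> ([], xs) \<in> tree_edges h ^^ length xs"
proof (induction xs rule: rev_induct)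
  case (snoc a xs)
  then have xs: "xs \<in> incseqs_le h" by (blast dest: incseqs_le_append1D)
  then have "(xs, xs @ [a]) \<in> tree_edges h"
    using snoc.prems by (auto simp: tree_edges_def)
  with snoc.IH[OF xs] show ?case by auto
qed auto

text \<open>Going up from \<open>x\<close> to the root and down to \<open>y\<close> is a walk, so
  the minimum in \<open>tree_dist\<close> ranges over a nonempty set and is attained.\<close>

lemma tree_dist_walk:
  assumes "x \<in> incseqs_le h" "y \<in> incseqs_le h"
  shows "(x, y) \<in> tree_edges h ^^ tree_dist h x y"
proof -
  have "(x, []) \<in> tree_edges h ^^ length x"
    by (rule sym_relpow[OF sym_tree_edges walk_from_root[OF assms(1)]])
  then have "(x, y) \<in> tree_edges h ^^ (length x + length y)"
    using walk_from_root[OF assms(2)] by (auto simp: relpow_add)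
  then show ?thesis
    unfolding tree_dist_def by (rule LeastI)
qed

lemma tree_dist_edge_le: "(x, y) \<in> tree_edges h \<Longrightarrow> tree_dist h x y \<le> 1"
  unfolding tree_dist_def by (rule Least_le) simp

text \<open>A potential that changes by at most one per edge bounds walk lengths from below, so
  lower bounds on distances need no description of shortest walks.\<close>

lemma walk_potential_diff_le:
  fixes g :: "'b \<Rightarrow> int"
  assumes "\<And>x y. (x, y) \<in> R \<Longrightarrow> \<bar>g x - g y\<bar> \<le> 1" "(x, y) \<in> R ^^ n"
  shows "\<bar>g x - g y\<bar> \<le> int n"
  using assms(2)
proof (induction n arbitrary: y)
  case (Suc n)
  then obtain z where z: "(x, z) \<in> R ^^ n" "(z, y) \<in> R" by auto
  show ?case using Suc.IH[OF z(1)] assms(1)[OF z(2)] by linarith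
qed auto

text \<open>A walk between the two branches must climb to \<open>ns\<close> and descend again. The
  signed depth records this: its values at the endpoints are \<open>length ms + 1\<close> and
  \<open>- (length ms' + 1)\<close>.\<close>

lemma tree_dist_branches_ge:
  assumes "ns @ i # ms \<in> incseqs_le h" "ns @ j # ms' \<in> incseqs_le h" "i \<noteq> j"
  shows "length ms + length ms' + 2 \<le> tree_dist h (ns @ i # ms) (ns @ j # ms')"
proof -
  txt \<open>The signed depth below \<open>ns\<close>: positive in the branch of \<open>i\<close>, negative in the branch of \<open>j\<close>.\<close>
  define g :: "nat list \<Rightarrow> int" where
    "g z = (if prefix (ns @ [i]) z then int (length z) - int (length ns)
            else if prefix (ns @ [j]) z then int (length ns) - int (length z) else 0)" for z
  have *: "\<bar>g z - g (z @ [a])\<bar> \<le> 1" for z a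
  proof -
    \<comment> \<open>Since the branches are disjoint, an edge enters or leaves one of them only at
      \<open>ns\<close>, where \<open>g\<close> is 0; no edge leads from one branch to the
      other.\<close>
    have "\<not> (prefix (ns @ [i]) z \<and> prefix (ns @ [j]) z)"
      using \<open>i \<noteq> j\<close> by (auto simp: prefix_def)
    then show ?thesis
      using \<open>i \<noteq> j\<close> by (auto simp: g_def)
  qed
  have edge: "\<bar>g x - g y\<bar> \<le> 1" if "(x, y) \<in> tree_edges h" for x y
    using that * by (auto simp: tree_edges_def abs_minus_commute)
  have "\<bar>g (ns @ i # ms) - g (ns @ j # ms')\<bar> \<le> int (tree_dist h (ns @ i # ms) (ns @ j # ms'))"
    using edge tree_dist_walk[OF assms(1,2)] by (rule walk_potential_diff_le)
  then show ?thesis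
    using \<open>i \<noteq> j\<close> by (simp add: g_def)
qed

text \<open>The triangle inequality is chained along a shortest walk, each edge of which contributes
  at most \<open>L\<close>.\<close>

lemma Lip_le_edge_bound:
  assumes "Metric_space M d" "g \<in> incseqs_le h \<rightarrow> M" "L \<ge> 0"
    and edge: "\<And>x y. (x, y) \<in> tree_edges h \<Longrightarrow> d (g x) (g y) \<le> L"
  shows "Lip (incseqs_le h) (\<lambda>x y. real (tree_dist h x y)) d g \<le> ennreal L"
proof -
  interpret Metric_space M d by fact
  have walk: "d (g x) (g y) \<le> real n * L"
    if "x \<in> incseqs_le h" "(x, y) \<in> tree_edges h ^^ n" for x y n
    using that(2)
  proof (induction n arbitrary: y)
    case 0
    moreover have "g x \<in> M" using assms(2) that(1) by auto
    ultimately show ?case by simp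
  next
    case (Suc n)
    then obtain z where z: "(x, z) \<in> tree_edges h ^^ n" "(z, y) \<in> tree_edges h" by auto
    then have "z \<in> incseqs_le h" "y \<in> incseqs_le h"
      by (auto simp: tree_edges_def)
    then have "d (g x) (g y) \<le> d (g x) (g z) + d (g z) (g y)"
      using assms(2) that(1) by (intro triangle) auto
    with Suc.IH[OF z(1)] edge[OF z(2)] show ?case
      by (simp add: algebra_simps)
  qed
  \<comment> \<open>At distance 0 the quotient is 0 by the convention for division by zero, and
    \<open>L \<ge> 0\<close> settles this case.\<close>
  have "d (g x) (g y) / real (tree_dist h x y) \<le> L"
    if "x \<in> incseqs_le h" "y \<in> incseqs_le h" for x y
    using walk[OF that(1) tree_dist_walk[OF that]] \<open>L \<ge> 0\<close>
    by (cases "tree_dist h x y = 0") (auto simp: divide_le_eq mult.commute)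
  then show ?thesis
    unfolding Lip_def by (intro SUP_least) (auto intro!: ennreal_leI)
qed

lemma ennreal_powr_le:
  assumes "x \<le> ennreal L" "L \<ge> 0" "p > 0"
  shows "ennreal_powr x p \<le> ennreal (L powr p)"
proof -
  have "x \<noteq> \<infinity>" using assms(1) by (auto simp: top_unique)
  moreover have "enn2real x \<le> L"
    using assms by (simp add: enn2real_leI)
  ultimately show ?thesis
    using assms by (auto simp: ennreal_powr_def intro!: ennreal_leI powr_mono2)
qed

text \<open>The exponent is found for the integer part of \<open>t\<close>; it also works for
  \<open>t\<close> because both endpoints are integers.\<close>

lemma dyadic_interval_ex:
  fixes t :: real
  assumes "t \<ge> 1"
  obtains s :: nat where "2 ^ s \<le> t" "t < 2 ^ (s + 1)"
proof -
  have "nat \<lfloor>t\<rfloor> \<ge> 1" using assms by (simp add: le_nat_iff)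
  then obtain s where s: "2 ^ s \<le> nat \<lfloor>t\<rfloor>" "nat \<lfloor>t\<rfloor> < 2 ^ (s + 1)"
    using ex_power_ivl1[of 2 "nat \<lfloor>t\<rfloor>"] by auto
  have "real (2 ^ s) \<le> t" "t < real (2 ^ (s + 1))"
    using s assms by linarith+
  then show ?thesis by (intro that[of s]) simp_all
qed

text \<open>On each dyadic block \<open>\<rho> t\<close> is bounded by its value at the right end
  and \<open>1 / t\<close> by its value at the left end, so a step function dominates the
  integrand.\<close>

lemma nn_integral_le_dyadic_sum:
  fixes \<rho> :: "real \<Rightarrow> real"
  assumes "p > 0" "\<rho> \<in> {0..} \<rightarrow> {0..}" "mono_on {0..} \<rho>"
  shows "(\<integral>\<^sup>+ t \<in> {1..}. ennreal ((\<rho> t / t) powr p / t) \<partial>lborel)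
           \<le> (\<Sum>s. ennreal ((\<rho> (2 ^ (s + 1)) / 2 ^ s) powr p))"
proof -
  define a where "a s = (\<rho> (2 ^ (s + 1)) / 2 ^ s) powr p" for s :: nat
  define b where "b s t = ennreal (a s / 2 ^ s) * indicator {2 ^ s..<2 ^ (s + 1)} t"
    for s :: nat and t :: real
  have "ennreal ((\<rho> t / t) powr p / t) \<le> (\<Sum>s. b s t)" if t: "t \<ge> 1" for t
  proof -
    obtain s :: nat where s: "2 ^ s \<le> t" "t < 2 ^ (s + 1)"
      using dyadic_interval_ex[OF t] .
    have "\<rho> t \<ge> 0" using assms(2) t by auto
    moreover have "\<rho> t \<le> \<rho> (2 ^ (s + 1))"
      using s t by (intro mono_onD[OF assms(3)]) auto
    ultimately have "(\<rho> t / t) powr p \<le> a s"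
      unfolding a_def using t s assms(1) by (intro powr_mono2 frac_le) auto
    then have "(\<rho> t / t) powr p / t \<le> a s / 2 ^ s"
      using s by (intro frac_le) (auto simp: a_def)
    then have "ennreal ((\<rho> t / t) powr p / t) \<le> b s t"
      using s by (simp add: b_def ennreal_leI)
    also have "\<dots> \<le> (\<Sum>s. b s t)"
      using sum_le_suminf[of "\<lambda>s. b s t" "{s}"] by simp
    finally show ?thesis .
  qed
  then have "(\<integral>\<^sup>+ t \<in> {1..}. ennreal ((\<rho> t / t) powr p / t) \<partial>lborel) \<le> (\<integral>\<^sup>+ t. (\<Sum>s. b s t) \<partial>lborel)"
    by (intro nn_integral_mono) (auto split: split_indicator)
  also have "\<dots> = (\<Sum>s. \<integral>\<^sup>+ t. b s t \<partial>lborel)"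
    unfolding b_def by (intro nn_integral_suminf) measurable
  \<comment> \<open>The block has length \<open>2 ^ s\<close>, which cancels the denominator coming
    from the factor \<open>1 / t\<close>.\<close>
  also have "(\<lambda>s. \<integral>\<^sup>+ t. b s t \<partial>lborel) = (\<lambda>s. ennreal (a s))"
    unfolding b_def
    by (subst nn_integral_cmult_indicator) (auto simp: a_def simp flip: ennreal_mult)
  finally show ?thesis by (simp add: a_def)
qed

theorem theoremB:
  fixes p :: real
    and Y :: "'a set" and dY :: "'a \<Rightarrow> 'a \<Rightarrow> real"
    and \<rho> \<omega> :: "real \<Rightarrow> real"
    and f :: "nat \<Rightarrow> nat list \<Rightarrow> 'a"
  assumes "p > 0"
    and "Metric_space Y dY"
    and "infrasup_umbel_convex p Y dY"
    and "\<rho> \<in> {0..} \<rightarrow> {0..}" and "\<omega> \<in> {0..} \<rightarrow> {0..}"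
    and "mono_on {0..} \<rho>" and "mono_on {0..} \<omega>"
    and "filterlim \<rho> at_top at_top"
    and "\<And>k. k \<ge> 1 \<Longrightarrow> f k \<in> incseqs_le k \<rightarrow> Y"
    and "\<And>k x y. k \<ge> 1 \<Longrightarrow> x \<in> incseqs_le k \<Longrightarrow> y \<in> incseqs_le k \<Longrightarrow>
           \<rho> (real (tree_dist k x y)) \<le> dY (f k x) (f k y) \<and>
           dY (f k x) (f k y) \<le> \<omega> (real (tree_dist k x y))"
  shows "(\<integral>\<^sup>+ t \<in> {1..}. ennreal ((\<rho> t / t) powr p / t) \<partial>lborel) < \<infinity>"
proof -
  note rho = assms(4,6) and bounds = assms(10)
  define a where "a s = (\<rho> (2 ^ (s + 1)) / 2 ^ s) powr p" for s :: nat
  have \<omega>1: "\<omega> 1 \<ge> 0" using assms(5) by auto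
  obtain C :: real where
    C: "\<And>k g. k \<ge> 1 \<Longrightarrow> g \<in> incseqs_le (2 ^ k) \<rightarrow> Y \<Longrightarrow>
      (\<Sum>s = 1..k - 1.
         INF ns \<in> incseqs_le (2 ^ k - 2 ^ s).
         INF (i, j) \<in> {(i, j). i \<in> {1..} \<and> j \<in> {1..} \<and> i \<noteq> j}.
         INF (ms, ms') \<in> {(ms, ms'). ms \<in> incseqs_eq (2 ^ s - 1) \<and> ms' \<in> incseqs_eq (2 ^ s - 1) \<and>
                             ns @ i # ms \<in> incseqs_le (2 ^ k) \<and> ns @ j # ms' \<in> incseqs_le (2 ^ k)}.
           ennreal (dY (g (ns @ i # ms)) (g (ns @ j # ms')) powr p / 2 powr (real s * p)))
      \<le> ennreal (C powr p) *
         ennreal_powr (Lip (incseqs_le (2 ^ k)) (\<lambda>x y. real (tree_dist (2 ^ k) x y)) dY g) p"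
    using assms(3) unfolding infrasup_umbel_convex_def by meson
  define B where "B = ennreal (C powr p) * ennreal (\<omega> 1 powr p)"
  have term_ge: "ennreal (a s) \<le>
      ennreal (dY (f (2 ^ k) (ns @ i # ms)) (f (2 ^ k) (ns @ j # ms')) powr p / 2 powr (real s * p))"
    if "i \<noteq> j" "ms \<in> incseqs_eq (2 ^ s - 1)" "ms' \<in> incseqs_eq (2 ^ s - 1)"
      "ns @ i # ms \<in> incseqs_le (2 ^ k)" "ns @ j # ms' \<in> incseqs_le (2 ^ k)"
    for k s ns i j ms ms'
  proof -
    let ?D = "tree_dist (2 ^ k) (ns @ i # ms) (ns @ j # ms')"
    let ?d = "dY (f (2 ^ k) (ns @ i # ms)) (f (2 ^ k) (ns @ j # ms'))"
    have "length ms = 2 ^ s - 1" "length ms' = 2 ^ s - 1"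
      using that by (auto simp: incseqs_eq_def)
    \<comment> \<open>This makes the truncated subtraction exact:
      \<open>(2 ^ s - 1) + (2 ^ s - 1) + 2 = 2 ^ (s + 1)\<close>.\<close>
    moreover have "(2::nat) ^ s \<ge> 1" by simp
    ultimately have "2 ^ (s + 1) \<le> ?D"
      using tree_dist_branches_ge[OF that(4,5,1)] by simp
    then have "real (2 ^ (s + 1)) \<le> real ?D"
      by (rule of_nat_mono)
    then have "\<rho> (2 ^ (s + 1)) \<le> \<rho> (real ?D)"
      by (intro mono_onD[OF rho(2)]) auto
    also have "\<dots> \<le> ?d"
      using bounds[of "2 ^ k"] that by simp
    finally have le: "\<rho> (2 ^ (s + 1)) \<le> ?d" .
    have ge0: "\<rho> (2 ^ (s + 1)) \<ge> 0"
      using rho(1) by auto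
    have "a s \<le> (?d / 2 ^ s) powr p"
      unfolding a_def using le ge0 assms(1) by (intro powr_mono2 divide_right_mono) auto
    also have "\<dots> = ?d powr p / 2 powr (real s * p)"
      using le ge0 by (simp add: powr_divide powr_realpow[symmetric] powr_powr)
    finally show ?thesis by (rule ennreal_leI)
  qed
  have partial: "(\<Sum>s = 1..k - 1. ennreal (a s)) \<le> B" if "k \<ge> 1" for k
  proof -
    have f: "f (2 ^ k) \<in> incseqs_le (2 ^ k) \<rightarrow> Y"
      using assms(9) by simp
    have edge: "dY (f (2 ^ k) x) (f (2 ^ k) y) \<le> \<omega> 1" if "(x, y) \<in> tree_edges (2 ^ k)" for x y
    proof -
      have "x \<in> incseqs_le (2 ^ k)" "y \<in> incseqs_le (2 ^ k)"
        using that by (auto simp: tree_edges_def)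
      then have "dY (f (2 ^ k) x) (f (2 ^ k) y) \<le> \<omega> (real (tree_dist (2 ^ k) x y))"
        using bounds[of "2 ^ k"] by simp
      \<comment> \<open>Adjacent vertices are at distance at most 1, and \<open>\<omega>\<close> is
        non-decreasing.\<close>
      also have "\<dots> \<le> \<omega> 1"
        using tree_dist_edge_le[OF that] by (intro mono_onD[OF assms(7)]) auto
      finally show ?thesis .
    qed
    show ?thesis
      unfolding B_def
    proof (rule order_trans[OF order_trans[OF _ C[OF that f]]])
      show "ennreal (C powr p) * ennreal_powr
          (Lip (incseqs_le (2 ^ k)) (\<lambda>x y. real (tree_dist (2 ^ k) x y)) dY (f (2 ^ k))) p
          \<le> ennreal (C powr p) * ennreal (\<omega> 1 powr p)"
        by (intro mult_left_mono ennreal_powr_le Lip_le_edge_bound[OF assms(2) f] edge \<omega>1 assms(1)) auto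
    \<comment> \<open>A lower bound on all members passes to the nested infima; an empty family has
      infimum \<open>\<infinity>\<close>, which respects the bound as well.\<close>
    qed (auto intro!: sum_mono INF_greatest term_ge)
  qed
  \<comment> \<open>The convexity sum starts at \<open>s = 1\<close>, so the finite term
    \<open>a 0\<close> is added separately; the rest is the partial sum for
    \<open>k = n\<close>.\<close>
  have "(\<Sum>s<n. ennreal (a s)) \<le> ennreal (a 0) + B" for n
  proof (cases n)
    case (Suc m)
    have "{..<n} = insert 0 {1..n - 1}" using Suc by auto
    then have "(\<Sum>s<n. ennreal (a s)) = ennreal (a 0) + (\<Sum>s = 1..n - 1. ennreal (a s))"
      by simp
    then show ?thesis using partial[of n] Suc by (simp add: add_left_mono)
  qed simp
  then have "(\<Sum>s. ennreal (a s)) \<le> ennreal (a 0) + B"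
    by (intro suminf_le_const) auto
  moreover have "(\<integral>\<^sup>+ t \<in> {1..}. ennreal ((\<rho> t / t) powr p / t) \<partial>lborel) \<le> (\<Sum>s. ennreal (a s))"
    unfolding a_def using assms(1) rho by (rule nn_integral_le_dyadic_sum)
  moreover have "ennreal (a 0) + B < \<infinity>"
    by (simp add: B_def ennreal_mult_less_top)
  ultimately show ?thesis by (meson le_less_trans)
qed

end
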